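(* For every graph $\mathcal{G}$ with vertex set $\{1,\dots,p\}$, $$\rho_{\mathrm{concord}}(\mathcal{G}) = \rho_{\mathrm{conspace}}(\mathcal{G}) \leq \rho_{\mathrm{conspace}}^{*}(\mathcal{G}) = \rho_{\mathrm{concord}}^{*}(\mathcal{G}).$$
   Context: Graphs are finite, simple and undirected, $\mathcal{G}=(V,E)$ with $V=\{1,\dots,p\}$, $p\ge 1$, and $E\subseteq\{\{i,j\}: i,j\in V,\ i\neq j\}$. $\mathcal{S}$ is the space of real symmetric $p\times p$ matrices. $\mathcal{S}_{\mathcal{G}}=\{\Omega\in\mathcal{S}: \Omega_{ij}=0 \text{ for all } i\neq j \text{ with } \{i,j\}\notin E\}$ (diagonal entries are unconstrained). $\mathcal{D}_{\mathcal{G}}^{++}=\{\Omega\in\mathcal{S}_{\mathcal{G}}:\Omega_{ii}>0\ \forall i\}$. For a positive semidefinite $A\in\mathcal{S}$ and $\Omega\in\mathcal{D}_{\mathcal{G}}^{++}$ with columns $\Omega_{\cdot 1},\dots,\Omega_{\cdot p}$, the CONCORD objective is $C_A(\Omega)=-2\sum_{i=1}^p\log\Omega_{ii}+\sum_{i=1}^p\Omega_{\cdot i}^{\top}A\,\Omega_{\cdot i}$, and the CONSPACE objective is $H_A(\Omega)=-2\sum_{i=1}^p\log\Omega_{ii}+\sum_{i=1}^p\Omega_{ii}^{-1}\Omega_{\cdot i}^{\top}A\,\Omega_{\cdot i}$. A symmetric matrix $A$ is in general position if every $q\times q$ principal submatrix of $A$ has rank $\min\{q,\operatorname{rank}(A)\}$.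 "For almost every $A\succeq 0$ with $\operatorname{rank}(A)\ge\rho$" means: for each integer $r$ with $\rho\le r\le p$, the property holds for $A=X^\top X$ for Lebesgue-almost every $X\in\mathbb{R}^{r\times p}$. Weak ranks: $\rho_{\mathrm{concord}}(\mathcal{G})$ (resp. $\rho_{\mathrm{conspace}}(\mathcal{G})$) is the smallest $\rho\in\mathbb{N}$ such that a unique minimizer of $C_A$ (resp. $H_A$) exists on $\mathcal{D}_{\mathcal{G}}^{++}$ for almost every $A\succeq 0$ with $\operatorname{rank}(A)\ge\rho$. Strong ranks: $\rho^*_{\mathrm{concord}}(\mathcal{G})$ (resp. $\rho^*_{\mathrm{conspace}}(\mathcal{G})$) is the smallest $\rho^*\in\mathbb{N}$ such that a unique minimizer of $C_A$ (resp. $H_A$) exists on $\mathcal{D}_{\mathcal{G}}^{++}$ for every $A\succeq0$ in general position with $\operatorname{rank}(A)\ge\rho^*$. *)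

theory Defs
  imports
    "HOL-Analysis.Analysis"
    "Jordan_Normal_Form.DL_Rank_Submatrix"
begin

text \<open>
  The vertices \<open>1, \<dots>, p\<close> are numbered \<open>0, \<dots>, p - 1\<close>, in accordance with the
  zero-based indices of the type \<^typ>\<open>'a mat\<close>. A graph is given by \<open>p\<close> and its edge set.
\<close>

definition simple_graph :: "nat \<Rightarrow> nat set set \<Rightarrow> bool" where
  "simple_graph p E \<longleftrightarrow> E \<subseteq> {{i, j} | i j. i < p \<and> j < p \<and> i \<noteq> j}"

definition sym_mats :: "nat \<Rightarrow> real mat set" where
  "sym_mats p = {A \<in> carrier_mat p p. transpose_mat A = A}"

definition psd_mats :: "nat \<Rightarrow> real mat set" where
  "psd_mats p = {A \<in> sym_mats p. \<forall>v \<in> carrier_vec p. scalar_prod v (A *\<^sub>v v) \<ge> 0}"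

definition graph_mats :: "nat \<Rightarrow> nat set set \<Rightarrow> real mat set" where
  "graph_mats p E =
     {\<Omega> \<in> sym_mats p. \<forall>i<p. \<forall>j<p. i \<noteq> j \<longrightarrow> {i, j} \<notin> E \<longrightarrow> \<Omega> $$ (i, j) = 0}"

definition pos_diag_graph_mats :: "nat \<Rightarrow> nat set set \<Rightarrow> real mat set" where
  "pos_diag_graph_mats p E = {\<Omega> \<in> graph_mats p E. \<forall>i<p. \<Omega> $$ (i, i) > 0}"

definition concord :: "nat \<Rightarrow> real mat \<Rightarrow> real mat \<Rightarrow> real" where
  "concord p A \<Omega> =
     - 2 * (\<Sum>i<p. ln (\<Omega> $$ (i, i)))
     + (\<Sum>i<p. scalar_prod (col \<Omega> i) (A *\<^sub>v col \<Omega> i))"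

definition conspace :: "nat \<Rightarrow> real mat \<Rightarrow> real mat \<Rightarrow> real" where
  "conspace p A \<Omega> =
     - 2 * (\<Sum>i<p. ln (\<Omega> $$ (i, i)))
     + (\<Sum>i<p. inverse (\<Omega> $$ (i, i)) * scalar_prod (col \<Omega> i) (A *\<^sub>v col \<Omega> i))"

definition has_unique_minimizer :: "('a \<Rightarrow> real) \<Rightarrow> 'a set \<Rightarrow> bool" where
  "has_unique_minimizer f D \<longleftrightarrow> (\<exists>!x. is_arg_min f (\<lambda>x. x \<in> D) x)"

text \<open>The first argument of \<^const>\<open>vec_space.rank\<close> is the number of rows.\<close>

definition general_position :: "nat \<Rightarrow> real mat \<Rightarrow> bool" where
  "general_position p A \<longleftrightarrow>
     (\<forall>I \<subseteq> {..<p}. vec_space.rank (card I) (submatrix A I I) = min (card I) (vec_space.rank p A))"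

text \<open>
  Lebesgue measure on the space of real \<open>r \<times> p\<close> matrices: the entries form a point of the
  product of \<open>r * p\<close> copies of \<^const>\<open>lborel\<close>. Passing to the completion would
  not change the meaning of AE.
\<close>

definition almost_every_psd :: "nat \<Rightarrow> nat \<Rightarrow> (real mat \<Rightarrow> bool) \<Rightarrow> bool" where
  "almost_every_psd p \<rho> P \<longleftrightarrow>
     (\<forall>r. \<rho> \<le> r \<and> r \<le> p \<longrightarrow>
        (AE x in Pi\<^sub>M ({..<r} \<times> {..<p}) (\<lambda>_. lborel).
           P (transpose_mat (mat r p x) * mat r p x)))"

text \<open>
  The argument \<open>F p A\<close> is the objective, to be instantiated with \<^const>\<open>concord\<close> or
  \<^const>\<open>conspace\<close>. In both definitions \<open>p + 1\<close> satisfies the condition vacuously, so the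
  least element exists.
\<close>

definition weak_rank ::
    "(nat \<Rightarrow> real mat \<Rightarrow> real mat \<Rightarrow> real) \<Rightarrow> nat \<Rightarrow> nat set set \<Rightarrow> nat" where
  "weak_rank F p E =
     (LEAST \<rho>. almost_every_psd p \<rho> (\<lambda>A. has_unique_minimizer (F p A) (pos_diag_graph_mats p E)))"

definition strong_rank ::
    "(nat \<Rightarrow> real mat \<Rightarrow> real mat \<Rightarrow> real) \<Rightarrow> nat \<Rightarrow> nat set set \<Rightarrow> nat" where
  "strong_rank F p E =
     (LEAST \<rho>. \<forall>A \<in> psd_mats p. general_position p A \<and> \<rho> \<le> vec_space.rank p A \<longrightarrow>
        has_unique_minimizer (F p A) (pos_diag_graph_mats p E))"

end

theory Submission
  imports Defs
begin

text \<open>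
  For a fixed positive semidefinite \<open>A\<close>, each objective has a unique minimizer if and only if no
  nonzero \<open>K\<close> in the closed cone of graph matrices with nonnegative diagonal satisfies \<open>A K = 0\<close>.
  Moving along such a \<open>K\<close> never increases the objective. Without such a \<open>K\<close>, compactness of
  the unit slice of the cone makes the quadratic part grow fast enough for sublevel sets to be
  compact, and strict convexity gives uniqueness. Hence the weak ranks agree, and so do the strong
  ranks. The inequality holds because \<open>X\<^sup>T X\<close> is in general position and has rank \<open>r\<close> for
  almost every \<open>r \<times> p\<close> matrix \<open>X\<close> with \<open>r \<le> p\<close>.
\<close>

section \<open>Existence and uniqueness of minimizers\<close>

definition bform :: "nat \<Rightarrow> (nat \<Rightarrow> nat \<Rightarrow> real) \<Rightarrow> (nat \<Rightarrow> real) \<Rightarrow> (nat \<Rightarrow> real) \<Rightarrow> real" where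
  "bform p a x y = (\<Sum>j<p. \<Sum>k<p. x j * a j k * y k)"

text \<open>Symmetric matrices are encoded as functions vanishing outside \<open>{..<p} \<times> {..<p}\<close>, so that the
  product topology applies; \<open>\<omega> i\<close> is the \<open>i\<close>-th column.\<close>
definition graph_cone :: "nat \<Rightarrow> nat set set \<Rightarrow> (nat \<Rightarrow> nat \<Rightarrow> real) set" where
  "graph_cone p E = {\<omega>. (\<forall>i j. \<omega> i j = \<omega> j i) \<and> (\<forall>i j. \<not> (i < p \<and> j < p) \<longrightarrow> \<omega> i j = 0)
     \<and> (\<forall>i j. i \<noteq> j \<longrightarrow> {i, j} \<notin> E \<longrightarrow> \<omega> i j = 0) \<and> (\<forall>i<p. 0 \<le> \<omega> i i)}"

definition pos_graph_cone :: "nat \<Rightarrow> nat set set \<Rightarrow> (nat \<Rightarrow> nat \<Rightarrow> real) set" where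
  "pos_graph_cone p E = {\<omega> \<in> graph_cone p E. \<forall>i<p. 0 < \<omega> i i}"

definition objective ::
    "nat \<Rightarrow> (nat \<Rightarrow> nat \<Rightarrow> real) \<Rightarrow> (real \<Rightarrow> real) \<Rightarrow> (nat \<Rightarrow> nat \<Rightarrow> real) \<Rightarrow> real" where
  "objective p a w \<omega> =
     - 2 * (\<Sum>i<p. ln (\<omega> i i)) + (\<Sum>i<p. w (\<omega> i i) * bform p a (\<omega> i) (\<omega> i))"

text \<open>For \<open>a\<close> positive semidefinite, \<open>bform p a x x = 0\<close> means that \<open>a\<close> annihilates \<open>x\<close>.\<close>
definition nondegenerate :: "nat \<Rightarrow> nat set set \<Rightarrow> (nat \<Rightarrow> nat \<Rightarrow> real) \<Rightarrow> bool" where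
  "nondegenerate p E a \<longleftrightarrow>
     (\<forall>\<omega> \<in> graph_cone p E. (\<forall>i<p. bform p a (\<omega> i) (\<omega> i) = 0) \<longrightarrow> \<omega> = (\<lambda>_ _. 0))"

section \<open>Bilinearity and the topology of the matrix cone\<close>

lemma bform_combine_left:
  "bform p a (\<lambda>j. s * x j + t * y j) z = s * bform p a x z + t * bform p a y z"
  unfolding bform_def sum_distrib_left sum.distrib[symmetric]
  by (intro sum.cong refl) (simp add: algebra_simps)

lemma bform_combine_right:
  "bform p a z (\<lambda>j. s * x j + t * y j) = s * bform p a z x + t * bform p a z y"
  unfolding bform_def sum_distrib_left sum.distrib[symmetric]
  by (intro sum.cong refl) (simp add: algebra_simps)

lemma continuous_on_entry: "continuous_on S (\<lambda>\<omega> :: nat \<Rightarrow> nat \<Rightarrow> real. \<omega> i j)"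
  by (rule continuous_on_product_then_coordinatewise[OF
        continuous_on_product_then_coordinatewise[OF continuous_on_id]])

lemma continuous_on_bform:
  "continuous_on S (\<lambda>\<omega> :: nat \<Rightarrow> nat \<Rightarrow> real. bform p a (\<omega> i) (\<omega> i))"
  unfolding bform_def
  by (intro continuous_on_sum continuous_on_mult continuous_on_const continuous_on_entry)

text \<open>Tychonoff's theorem, applied once to each of the two index levels.\<close>

lemma compact_box: "compact {\<omega> :: nat \<Rightarrow> nat \<Rightarrow> real. \<forall>i j. \<bar>\<omega> i j\<bar> \<le> B}"
proof -
  have PiE_compact: "compact (PiE UNIV (\<lambda>_. S))" if "compact S"
    for S :: "'b::topological_space set"
  proof -
    have "compactin (product_topology (\<lambda>_::'c. euclidean) UNIV) (PiE UNIV (\<lambda>_. S))"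
      using that by (subst compactin_PiE) auto
    then show ?thesis
      by (simp add: euclidean_product_topology)
  qed
  have "{\<omega> :: nat \<Rightarrow> nat \<Rightarrow> real. \<forall>i j. \<bar>\<omega> i j\<bar> \<le> B}
      = PiE UNIV (\<lambda>_. PiE UNIV (\<lambda>_. {- B..B}))"
    by (auto simp: PiE_UNIV_domain abs_le_iff Pi_iff) (metis minus_le_iff)+
  then show ?thesis
    by (simp add: PiE_compact)
qed

lemma closed_graph_cone: "closed (graph_cone p E)"
proof -
  have eq: "graph_cone p E = (\<Inter>i. \<Inter>j. {\<omega>. \<omega> i j = \<omega> j i})
      \<inter> (\<Inter>(i, j) \<in> {(i, j). \<not> (i < p \<and> j < p) \<or> i \<noteq> j \<and> {i, j} \<notin> E}. {\<omega>. \<omega> i j = 0})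
      \<inter> (\<Inter>i\<in>{..<p}. {\<omega>. 0 \<le> \<omega> i i})"
    by (auto simp: graph_cone_def)
  have closed_entries: "closed {\<omega> :: nat \<Rightarrow> nat \<Rightarrow> real. \<omega> i j = \<omega> j i}"
      "closed {\<omega> :: nat \<Rightarrow> nat \<Rightarrow> real. \<omega> i j = 0}"
      "closed {\<omega> :: nat \<Rightarrow> nat \<Rightarrow> real. 0 \<le> \<omega> i i}" for i j
    by (intro closed_Collect_eq closed_Collect_le continuous_on_entry continuous_on_const)+
  show ?thesis
    unfolding eq
    by (intro closed_Int closed_INT ballI) (simp_all add: closed_entries split: prod.split)
qed

text \<open>This is the entrywise l1 norm. It scales nonzero elements of the cone to a compact slice
  and bounds every single entry.\<close>

definition entry_sum :: "nat \<Rightarrow> (nat \<Rightarrow> nat \<Rightarrow> real) \<Rightarrow> real" where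
  "entry_sum p \<omega> = (\<Sum>i<p. \<Sum>j<p. \<bar>\<omega> i j\<bar>)"

lemma continuous_on_entry_sum: "continuous_on S (entry_sum p)"
  unfolding entry_sum_def by (intro continuous_on_sum continuous_on_rabs continuous_on_entry)

lemma entry_sum_nonneg: "0 \<le> entry_sum p \<omega>"
  unfolding entry_sum_def by (intro sum_nonneg) auto

lemma abs_entry_le_entry_sum:
  assumes "\<omega> \<in> graph_cone p E"
  shows "\<bar>\<omega> i j\<bar> \<le> entry_sum p \<omega>"
proof (cases "i < p \<and> j < p")
  case True
  then have "\<bar>\<omega> i j\<bar> \<le> (\<Sum>j<p. \<bar>\<omega> i j\<bar>)" by (intro member_le_sum) auto
  also have "\<dots> \<le> entry_sum p \<omega>"
    unfolding entry_sum_def using True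
    by (intro member_le_sum[where f = "\<lambda>i. \<Sum>j<p. \<bar>\<omega> i j\<bar>"]) (auto intro: sum_nonneg)
  finally show ?thesis .
next
  case False
  then show ?thesis using assms entry_sum_nonneg[of p \<omega>] by (auto simp: graph_cone_def)
qed

lemma sum_diag_le_entry_sum:
  assumes "\<omega> \<in> graph_cone p E"
  shows "(\<Sum>i<p. \<omega> i i) \<le> entry_sum p \<omega>"
  unfolding entry_sum_def
proof (rule sum_mono)
  fix i assume "i \<in> {..<p}"
  then have "\<bar>\<omega> i i\<bar> \<le> (\<Sum>j<p. \<bar>\<omega> i j\<bar>)" by (intro member_le_sum) auto
  then show "\<omega> i i \<le> (\<Sum>j<p. \<bar>\<omega> i j\<bar>)" by simp
qed

lemma graph_cone_combine:
  assumes "\<omega> \<in> graph_cone p E" "\<eta> \<in> graph_cone p E" "0 \<le> s" "0 \<le> t"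
  shows "(\<lambda>i j. s * \<omega> i j + t * \<eta> i j) \<in> graph_cone p E"
  using assms by (auto simp: graph_cone_def)

text \<open>The weight \<open>w\<close> is constantly \<open>1\<close> for CONCORD and \<open>inverse\<close> for CONSPACE.\<close>
locale weighted_objective =
  fixes p :: nat and E :: "nat set set" and a :: "nat \<Rightarrow> nat \<Rightarrow> real" and w :: "real \<Rightarrow> real"
  assumes sym: "j < p \<Longrightarrow> k < p \<Longrightarrow> a j k = a k j"
    and psd: "0 \<le> bform p a x x"
    and w_cont: "continuous_on {0<..} w"
    and w_pos: "0 < s \<Longrightarrow> 0 < w s"
    and w_antimono: "0 < s \<Longrightarrow> s \<le> t \<Longrightarrow> w t \<le> w s"
    and w_ge: "1 \<le> s \<Longrightarrow> 1 / s \<le> w s"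
    and w_convex: "0 < s \<Longrightarrow> 0 < t \<Longrightarrow>
      w ((s + t) / 2) * bform p a (\<lambda>j. 1/2 * x j + 1/2 * y j) (\<lambda>j. 1/2 * x j + 1/2 * y j)
        \<le> (w s * bform p a x x + w t * bform p a y y) / 2"
begin

lemma bform_commute: "bform p a x y = bform p a y x"
proof -
  have "bform p a x y = (\<Sum>k<p. \<Sum>j<p. x j * a j k * y k)"
    unfolding bform_def by (rule sum.swap)
  also have "\<dots> = bform p a y x"
    unfolding bform_def by (intro sum.cong refl) (simp add: sym)
  finally show ?thesis .
qed

lemma bform_combine:
  "bform p a (\<lambda>j. s * x j + t * y j) (\<lambda>j. s * x j + t * y j)
     = s^2 * bform p a x x + 2 * s * t * bform p a x y + t^2 * bform p a y y"
  by (simp add: bform_combine_left bform_combine_right bform_commute[of y x]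
      power2_eq_square algebra_simps)

text \<open>Otherwise the form at \<open>x + t y\<close> would be affine in \<open>t\<close> with
  nonzero slope, hence negative for some \<open>t\<close>.\<close>

lemma bform_eq_0_of_isotropic:
  assumes "bform p a y y = 0"
  shows "bform p a x y = 0"
proof (rule ccontr)
  assume "bform p a x y \<noteq> 0"
  \<comment> \<open>With this \<open>t\<close> the form takes the value -1 at
    \<open>x + t y\<close>.\<close>
  moreover define t where "t = - (bform p a x x + 1) / (2 * bform p a x y)"
  ultimately have "2 * t * bform p a x y = - (bform p a x x + 1)"
    by (simp add: field_simps)
  moreover have "0 \<le> bform p a x x + 2 * t * bform p a x y"
    using psd[of "\<lambda>j. 1 * x j + t * y j"] unfolding bform_combine by (simp add: assms)
  ultimately show False by linarith
qed

text \<open>Adding a \<open>\<kappa>\<close> with isotropic columns to the minimizer keeps the form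
  of every column and does not decrease the diagonal. Since \<open>ln\<close> is increasing and
  \<open>w\<close> antitone, the sum is again a minimizer, so uniqueness forces
  \<open>\<kappa> = 0\<close>.\<close>

lemma nondegenerate_of_unique_minimizer:
  assumes "has_unique_minimizer (objective p a w) (pos_graph_cone p E)"
  shows "nondegenerate p E a"
  unfolding nondegenerate_def
proof (intro ballI impI)
  fix \<kappa> assume \<kappa>: "\<kappa> \<in> graph_cone p E" "\<forall>i<p. bform p a (\<kappa> i) (\<kappa> i) = 0"
  obtain \<omega> where \<omega>: "is_arg_min (objective p a w) (\<lambda>x. x \<in> pos_graph_cone p E) \<omega>"
    and uniq: "\<And>\<eta>. is_arg_min (objective p a w) (\<lambda>x. x \<in> pos_graph_cone p E) \<eta> \<Longrightarrow> \<eta> = \<omega>"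
    using assms unfolding has_unique_minimizer_def by blast
  have \<omega>_pos: "\<omega> \<in> pos_graph_cone p E" using \<omega> by (simp add: is_arg_min_def)
  \<comment> \<open>The factors 1 give the sum the shape required by
    \<open>bform_combine\<close>.\<close>
  define \<eta> where "\<eta> = (\<lambda>i j. 1 * \<omega> i j + 1 * \<kappa> i j)"
  have \<eta>_pos: "\<eta> \<in> pos_graph_cone p E"
    using \<omega>_pos \<kappa>(1) unfolding pos_graph_cone_def \<eta>_def
    by (auto simp: graph_cone_def intro!: add_pos_nonneg)
  have diag: "0 < \<omega> i i" "\<omega> i i \<le> \<eta> i i" if "i < p" for i
    using that \<omega>_pos \<kappa>(1) by (auto simp: pos_graph_cone_def graph_cone_def \<eta>_def)
  have "bform p a (\<eta> i) (\<eta> i) = bform p a (\<omega> i) (\<omega> i)" if "i < p" for i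
    using \<kappa>(2) that unfolding \<eta>_def bform_combine by (simp add: bform_eq_0_of_isotropic)
  then have "objective p a w \<eta> \<le> objective p a w \<omega>"
    unfolding objective_def
    by (intro add_mono mult_left_mono_neg sum_mono)
       (auto intro!: mult_right_mono w_antimono diag psd ln_mono less_le_trans[OF diag])
  then have "is_arg_min (objective p a w) (\<lambda>x. x \<in> pos_graph_cone p E) \<eta>"
    using \<omega> \<eta>_pos unfolding is_arg_min_def by force
  then have "\<eta> = \<omega>" by (rule uniq)
  then show "\<kappa> = (\<lambda>_ _. 0)"
    unfolding \<eta>_def by (intro ext) (metis (no_types) add_cancel_right_right mult_1)
qed

section \<open>Uniqueness by convexity\<close>

text \<open>Two minimizers are compared with their midpoint \<open>\<mu>\<close>. Strict concavity
  of \<open>ln\<close> makes their diagonals equal; equality in the quadratic part then makes the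
  columns of their difference isotropic, and nondegeneracy applies.\<close>

lemma minimizer_unique:
  assumes nd: "nondegenerate p E a"
    and \<omega>: "is_arg_min (objective p a w) (\<lambda>x. x \<in> pos_graph_cone p E) \<omega>"
    and \<eta>: "is_arg_min (objective p a w) (\<lambda>x. x \<in> pos_graph_cone p E) \<eta>"
  shows "\<omega> = \<eta>"
proof -
  define \<mu> where "\<mu> = (\<lambda>i j. 1/2 * \<omega> i j + 1/2 * \<eta> i j)"
  define q where "q = (\<lambda>x. bform p a x x)"
  have \<omega>_pos: "\<omega> \<in> pos_graph_cone p E" and \<eta>_pos: "\<eta> \<in> pos_graph_cone p E"
    using \<omega> \<eta> by (auto simp: is_arg_min_def)
  have pos: "0 < \<omega> i i" "0 < \<eta> i i" if "i < p" for i
    using that \<omega>_pos \<eta>_pos by (auto simp: pos_graph_cone_def)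
  have eq: "objective p a w \<omega> = objective p a w \<eta>"
    using \<omega> \<eta> by (force simp: is_arg_min_def)
  have "\<mu> \<in> pos_graph_cone p E"
    using \<omega>_pos \<eta>_pos unfolding pos_graph_cone_def \<mu>_def by (auto simp: graph_cone_def add_pos_pos)
  then have min: "objective p a w \<omega> \<le> objective p a w \<mu>"
    using \<omega> by (force simp: is_arg_min_def)
  have \<mu>_diag: "\<mu> i i = (\<omega> i i + \<eta> i i) / 2" for i
    by (simp add: \<mu>_def)
  have ln_mid: "0 \<le> ln (\<mu> i i) - (ln (\<omega> i i) + ln (\<eta> i i)) / 2
      \<and> (ln (\<mu> i i) - (ln (\<omega> i i) + ln (\<eta> i i)) / 2 = 0 \<longrightarrow> \<omega> i i = \<eta> i i)" if "i < p" for i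
  proof -
    \<comment> \<open>These are the squares of the geometric and the arithmetic mean of the two
      diagonal entries. As \<open>Q - P\<close> is a square, both the inequality and its equality
      case follow.\<close>
    define P Q where "P = \<omega> i i * \<eta> i i" and "Q = ((\<omega> i i + \<eta> i i) / 2)\<^sup>2"
    have PQ: "0 < P" "0 < Q" using pos[OF that] by (auto simp: P_def Q_def)
    have diff: "Q - P = ((\<omega> i i - \<eta> i i) / 2)\<^sup>2"
      by (simp add: P_def Q_def power2_eq_square field_simps)
    have "ln P \<le> ln Q" using PQ diff zero_le_power2[of "(\<omega> i i - \<eta> i i) / 2"]
      by (subst ln_le_cancel_iff) linarith+
    moreover have "\<omega> i i = \<eta> i i" if "ln P = ln Q"
      using that PQ diff by simp
    moreover have "ln (\<mu> i i) - (ln (\<omega> i i) + ln (\<eta> i i)) / 2 = (ln Q - ln P) / 2"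
    proof -
      have "ln P = ln (\<omega> i i) + ln (\<eta> i i)" using pos[OF that] by (simp add: P_def ln_mult)
      moreover have "ln Q = 2 * ln (\<mu> i i)"
        using pos[OF that] unfolding Q_def \<mu>_diag by (subst ln_realpow) auto
      ultimately show ?thesis by (simp add: field_simps)
    qed
    ultimately show ?thesis by (metis diff_ge_0_iff_ge divide_eq_0_iff divide_nonneg_nonneg
          diff_eq_eq add_0 zero_le_numeral zero_neq_numeral)
  qed
  have w_mid: "0 \<le> (w (\<omega> i i) * q (\<omega> i) + w (\<eta> i i) * q (\<eta> i)) / 2 - w (\<mu> i i) * q (\<mu> i)"
    if "i < p" for i
    using w_convex[OF pos[OF that], of "\<omega> i" "\<eta> i"] unfolding \<mu>_diag q_def by (simp add: \<mu>_def)
  \<comment> \<open>The midpoint gaps are nonnegative, and together they make up the mean of the two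
    minimal values minus the value at \<open>\<mu>\<close>, which is at most 0. So all gaps
    vanish.\<close>
  have "2 * (\<Sum>i<p. ln (\<mu> i i) - (ln (\<omega> i i) + ln (\<eta> i i)) / 2)
      + (\<Sum>i<p. (w (\<omega> i i) * q (\<omega> i) + w (\<eta> i i) * q (\<eta> i)) / 2 - w (\<mu> i i) * q (\<mu> i))
      = (objective p a w \<omega> + objective p a w \<eta>) / 2 - objective p a w \<mu>"
    unfolding objective_def q_def
    by (simp add: sum_subtractf sum.distrib sum_divide_distrib[symmetric]
        sum_distrib_left[symmetric] field_simps)
  also have "\<dots> \<le> 0" using min eq by simp
  finally have le: "2 * (\<Sum>i<p. ln (\<mu> i i) - (ln (\<omega> i i) + ln (\<eta> i i)) / 2)
      + (\<Sum>i<p. (w (\<omega> i i) * q (\<omega> i) + w (\<eta> i i) * q (\<eta> i)) / 2 - w (\<mu> i i) * q (\<mu> i)) \<le> 0" .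
  have ge: "0 \<le> (\<Sum>i<p. ln (\<mu> i i) - (ln (\<omega> i i) + ln (\<eta> i i)) / 2)"
      "0 \<le> (\<Sum>i<p. (w (\<omega> i i) * q (\<omega> i) + w (\<eta> i i) * q (\<eta> i)) / 2 - w (\<mu> i i) * q (\<mu> i))"
    using ln_mid w_mid by (auto intro!: sum_nonneg)
  have "(\<Sum>i<p. ln (\<mu> i i) - (ln (\<omega> i i) + ln (\<eta> i i)) / 2) = 0"
    using le ge by linarith
  then have "\<forall>i\<in>{..<p}. ln (\<mu> i i) - (ln (\<omega> i i) + ln (\<eta> i i)) / 2 = 0"
    using ln_mid by (subst (asm) sum_nonneg_eq_0_iff) auto
  then have diag: "\<omega> i i = \<eta> i i" if "i < p" for i
    using ln_mid that by blast
  have "(\<Sum>i<p. (w (\<omega> i i) * q (\<omega> i) + w (\<eta> i i) * q (\<eta> i)) / 2 - w (\<mu> i i) * q (\<mu> i)) = 0"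
    using le ge by linarith
  then have "\<forall>i\<in>{..<p}. (w (\<omega> i i) * q (\<omega> i) + w (\<eta> i i) * q (\<eta> i)) / 2 - w (\<mu> i i) * q (\<mu> i) = 0"
    using w_mid by (subst (asm) sum_nonneg_eq_0_iff) auto
  \<comment> \<open>Equal diagonals make the three weights coincide, so that they cancel
    below.\<close>
  then have w0: "(w (\<omega> i i) * q (\<omega> i) + w (\<omega> i i) * q (\<eta> i)) / 2 = w (\<omega> i i) * q (\<mu> i)"
    if "i < p" for i
    using that diag[OF that] \<mu>_diag[of i] by (metis diff_eq_eq add_0 field_sum_of_halves
        add_divide_distrib lessThan_iff)
  define \<kappa> where "\<kappa> = (\<lambda>i j. 1 * \<omega> i j + (- 1) * \<eta> i j)"
  \<comment> \<open>The difference lies in the cone because its diagonal is zero.\<close>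
  have "\<kappa> \<in> graph_cone p E"
    using \<omega>_pos \<eta>_pos diag by (auto simp: pos_graph_cone_def graph_cone_def \<kappa>_def)
  moreover have "bform p a (\<kappa> i) (\<kappa> i) = 0" if "i < p" for i
  proof -
    \<comment> \<open>By the parallelogram identity the two sides differ by a quarter of the form at
      \<open>\<kappa> i\<close>.\<close>
    have "(q (\<omega> i) + q (\<eta> i)) / 2 = q (\<mu> i)"
    proof -
      have "w (\<omega> i i) * ((q (\<omega> i) + q (\<eta> i)) / 2) = w (\<omega> i i) * q (\<mu> i)"
        using w0[OF that] by (simp add: distrib_left)
      then show ?thesis using w_pos[OF pos(1)[OF that]] by (metis mult_left_cancel less_irrefl)
    qed
    then show ?thesis
      unfolding q_def \<mu>_def \<kappa>_def bform_combine by (simp add: power2_eq_square)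
  qed
  ultimately have "\<kappa> = (\<lambda>_ _. 0)" using nd unfolding nondegenerate_def by blast
  then have "\<omega> i j = \<eta> i j" for i j
    unfolding \<kappa>_def by (metis (no_types) add_0 diff_eq_eq mult_1 mult_minus1
        uminus_add_conv_diff add.commute)
  then show ?thesis by blast
qed

section \<open>Existence by compact sublevel sets\<close>

text \<open>The constant is the minimum of the quadratic part over the compact slice of entry sum 1,
  which is positive by nondegeneracy. Homogeneity of degree 2 carries the bound to the whole
  cone.\<close>

lemma quadratic_growth:
  assumes nd: "nondegenerate p E a"
  obtains c where "0 < c"
    "\<And>\<omega>. \<omega> \<in> graph_cone p E \<Longrightarrow> c * (entry_sum p \<omega>)\<^sup>2 \<le> (\<Sum>i<p. bform p a (\<omega> i) (\<omega> i))"
proof -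
  define q where "q = (\<lambda>\<omega>. \<Sum>i<p. bform p a (\<omega> i) (\<omega> i))"
  define S where "S = graph_cone p E \<inter> {\<omega>. entry_sum p \<omega> = 1}"
  \<comment> \<open>The slice is closed, and all its entries lie in the compact box of radius
    1.\<close>
  have "compact ({\<omega> :: nat \<Rightarrow> nat \<Rightarrow> real. \<forall>i j. \<bar>\<omega> i j\<bar> \<le> 1} \<inter> S)"
    unfolding S_def
    by (intro compact_Int_closed compact_box closed_Int closed_graph_cone closed_Collect_eq
        continuous_on_entry_sum continuous_on_const)
  moreover have "{\<omega> :: nat \<Rightarrow> nat \<Rightarrow> real. \<forall>i j. \<bar>\<omega> i j\<bar> \<le> 1} \<inter> S = S"
    using abs_entry_le_entry_sum unfolding S_def by force
  ultimately have "compact S" by simp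
  have q_pos: "0 < q \<omega>" if "\<omega> \<in> S" for \<omega>
  proof -
    have "\<exists>i<p. bform p a (\<omega> i) (\<omega> i) \<noteq> 0"
    proof (rule ccontr)
      assume "\<not> ?thesis"
      then have "\<omega> = (\<lambda>_ _. 0)"
        using that by (intro nd[unfolded nondegenerate_def, rule_format]) (auto simp: S_def)
      then show False using that by (simp add: S_def entry_sum_def)
    qed
    then obtain i where i: "i < p" "bform p a (\<omega> i) (\<omega> i) \<noteq> 0" by blast
    then show ?thesis
      unfolding q_def using psd by (intro sum_pos2[of _ i]) (auto simp: less_le)
  qed
  obtain c where c: "0 < c" "\<And>\<omega>. \<omega> \<in> S \<Longrightarrow> c \<le> q \<omega>"
  proof (cases "S = {}")
    \<comment> \<open>The slice is empty only for \<open>p = 0\<close>; then any positive constant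
      serves.\<close>
    case True
    then show ?thesis using that[of 1] by simp
  next
    case False
    have "continuous_on S q"
      unfolding q_def by (intro continuous_on_sum continuous_on_bform)
    then obtain \<sigma> where "\<sigma> \<in> S" "\<forall>\<omega>\<in>S. q \<sigma> \<le> q \<omega>"
      using continuous_attains_inf[OF \<open>compact S\<close> False] by blast
    then show ?thesis using that[of "q \<sigma>"] q_pos by blast
  qed
  show ?thesis
  proof (rule that[OF c(1)])
    fix \<omega> assume \<omega>: "\<omega> \<in> graph_cone p E"
    define R where "R = entry_sum p \<omega>"
    show "c * (entry_sum p \<omega>)\<^sup>2 \<le> (\<Sum>i<p. bform p a (\<omega> i) (\<omega> i))"
    proof (cases "R = 0")
      case True
      then show ?thesis using psd by (simp add: R_def sum_nonneg)
    next
      case False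
      then have "0 < R" using entry_sum_nonneg[of p \<omega>] by (simp add: R_def)
      \<comment> \<open>The zero summand brings the rescaled matrix into the shape of
        \<open>graph_cone_combine\<close> and \<open>bform_combine\<close>.\<close>
      define \<sigma> where "\<sigma> = (\<lambda>i j. (1 / R) * \<omega> i j + 0 * \<omega> i j)"
      have "\<sigma> \<in> graph_cone p E"
        unfolding \<sigma>_def using \<omega> \<open>0 < R\<close> by (intro graph_cone_combine) auto
      moreover have "entry_sum p \<sigma> = 1"
        unfolding entry_sum_def \<sigma>_def using \<open>0 < R\<close>
        by (simp add: abs_mult sum_divide_distrib[symmetric]) (simp add: R_def entry_sum_def)
      ultimately have "c \<le> q \<sigma>" by (intro c(2)) (simp add: S_def)
      also have "q \<sigma> = q \<omega> / R\<^sup>2"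
        unfolding q_def \<sigma>_def bform_combine by (simp add: power_divide sum_divide_distrib)
      finally show ?thesis using \<open>0 < R\<close> by (simp add: field_simps q_def R_def)
    qed
  qed
qed

text \<open>The points doing no worse than the identity matrix lie in a compact set on which the
  diagonal stays away from 0. There the objective is continuous and attains its minimum.\<close>

lemma minimizer_exists:
  assumes nd: "nondegenerate p E a"
  shows "\<exists>\<omega>. is_arg_min (objective p a w) (\<lambda>x. x \<in> pos_graph_cone p E) \<omega>"
proof -
  obtain c where c: "0 < c"
    "\<And>\<omega>. \<omega> \<in> graph_cone p E \<Longrightarrow> c * (entry_sum p \<omega>)\<^sup>2 \<le> (\<Sum>i<p. bform p a (\<omega> i) (\<omega> i))"
    using quadratic_growth[OF nd] by blast
  define F where "F = objective p a w"
  (* m is the minimum over s > 0 of - 2 ln s + c s / 2, attained at s = 4 / c *)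
  define m where "m = 2 + 2 * ln (c / 4)"
  have ln_bound: "m \<le> - 2 * ln s + c / 2 * s" if "0 < s" for s
    using ln_le_minus_one[of "c / 4 * s"] that c(1) ln_mult[of "c / 4" s]
    unfolding m_def by (simp add: algebra_simps)
  \<comment> \<open>As the weight may decay like \<open>1 / s\<close>, only a linear rate remains of
    the quadratic growth. Subtracting \<open>c\<close> covers entry sums below 1.\<close>
  have linear_growth: "- 2 * (\<Sum>i<p. ln (\<omega> i i)) + c * entry_sum p \<omega> - c \<le> F \<omega>"
    if "\<omega> \<in> pos_graph_cone p E" for \<omega>
  proof -
    have \<omega>: "\<omega> \<in> graph_cone p E" using that by (simp add: pos_graph_cone_def)
    define R where "R = entry_sum p \<omega>"
    have "c * (R - 1) \<le> c * (R\<^sup>2 / max R 1)"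
      using c(1) entry_sum_nonneg[of p \<omega>] unfolding R_def[symmetric]
      by (intro mult_left_mono)
         (auto simp: max_def power2_eq_square intro: order_trans[of _ 0])
    also have "\<dots> \<le> 1 / max R 1 * (\<Sum>i<p. bform p a (\<omega> i) (\<omega> i))"
      using c(2)[OF \<omega>] by (simp add: R_def divide_right_mono)
    also have "\<dots> = (\<Sum>i<p. 1 / max R 1 * bform p a (\<omega> i) (\<omega> i))"
      by (rule sum_distrib_left)
    also have "\<dots> \<le> (\<Sum>i<p. w (\<omega> i i) * bform p a (\<omega> i) (\<omega> i))"
    proof (intro sum_mono mult_right_mono psd)
      fix i assume "i \<in> {..<p}"
      then have "0 < \<omega> i i" "\<omega> i i \<le> max R 1"
        using that abs_entry_le_entry_sum[OF \<omega>, of i i]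
        by (auto simp: pos_graph_cone_def R_def)
      \<comment> \<open>The weight at \<open>max R 1\<close> lies in between; the maximum with 1
        makes \<open>w_ge\<close> applicable.\<close>
      then show "1 / max R 1 \<le> w (\<omega> i i)"
        using w_antimono[of "\<omega> i i" "max R 1"] w_ge[of "max R 1"] by linarith
    qed
    finally show ?thesis unfolding F_def objective_def R_def by (simp add: algebra_simps)
  qed
  define \<iota> where "\<iota> = (\<lambda>i j. if i = j \<and> i < p then 1 else 0 :: real)"
  have \<iota>: "\<iota> \<in> pos_graph_cone p E" by (auto simp: pos_graph_cone_def graph_cone_def \<iota>_def)
  \<comment> \<open>Half of the linear growth absorbs the logarithms through
    \<open>ln_bound\<close>, and the other half bounds the entry sum. The maximum with 1 makes
    \<open>ln B\<close> nonnegative.\<close>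
  define B where "B = max 1 (2 / c * (F \<iota> + c - p * m))"
  have upper: "entry_sum p \<omega> \<le> B" if "\<omega> \<in> pos_graph_cone p E" "F \<omega> \<le> F \<iota>" for \<omega>
  proof -
    have "p * m \<le> (\<Sum>i<p. - 2 * ln (\<omega> i i) + c / 2 * \<omega> i i)"
      using sum_mono[of "{..<p}" "\<lambda>_. m" "\<lambda>i. - 2 * ln (\<omega> i i) + c / 2 * \<omega> i i"]
        that(1) ln_bound
      by (auto simp: pos_graph_cone_def)
    also have "\<dots> = - 2 * (\<Sum>i<p. ln (\<omega> i i)) + c / 2 * (\<Sum>i<p. \<omega> i i)"
      by (simp add: sum.distrib sum_distrib_left sum_negf sum_subtractf)
    also have "c / 2 * (\<Sum>i<p. \<omega> i i) \<le> c / 2 * entry_sum p \<omega>"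
      using c(1) sum_diag_le_entry_sum[of \<omega> p E] that(1)
      by (intro mult_left_mono) (auto simp: pos_graph_cone_def)
    finally have "c / 2 * entry_sum p \<omega> \<le> F \<iota> + c - p * m"
      using linear_growth[OF that(1)] that(2) by simp
    then have "entry_sum p \<omega> \<le> 2 / c * (F \<iota> + c - p * m)"
      using c(1) by (simp add: field_simps)
    then show ?thesis by (simp add: B_def)
  qed
  \<comment> \<open>The exponent comes from solving \<open>F \<omega> \<le> F \<iota>\<close> for
    one logarithm after bounding the others by \<open>ln B\<close>.\<close>
  define \<epsilon> where "\<epsilon> = min 1 (exp (- (F \<iota> + c + 2 * p * ln B) / 2))"
  have "1 \<le> B" by (simp add: B_def)
  have lower: "\<epsilon> \<le> \<omega> i i" if "\<omega> \<in> pos_graph_cone p E" "F \<omega> \<le> F \<iota>" "i < p" for \<omega> i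
  proof -
    have \<omega>: "\<omega> \<in> graph_cone p E" using that by (simp add: pos_graph_cone_def)
    have ln_le: "ln (\<omega> k k) \<le> ln B" if "k < p" for k
      using upper[OF \<open>\<omega> \<in> pos_graph_cone p E\<close> \<open>F \<omega> \<le> F \<iota>\<close>] abs_entry_le_entry_sum[OF \<omega>, of k k]
        \<open>\<omega> \<in> pos_graph_cone p E\<close> that
      by (auto simp: pos_graph_cone_def)
    have "(\<Sum>k<p. ln (\<omega> k k)) = ln (\<omega> i i) + (\<Sum>k\<in>{..<p} - {i}. ln (\<omega> k k))"
      using that(3) by (simp add: sum.remove)
    also have "(\<Sum>k\<in>{..<p} - {i}. ln (\<omega> k k)) \<le> real (card ({..<p} - {i})) * ln B"
      by (rule sum_bounded_above) (simp add: ln_le)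
    also have "\<dots> \<le> p * ln B"
      using \<open>1 \<le> B\<close> that(3) by (intro mult_right_mono) auto
    finally have "- (F \<iota> + c + 2 * p * ln B) / 2 \<le> ln (\<omega> i i)"
      using linear_growth[OF that(1)] that(2) mult_nonneg_nonneg[OF less_imp_le[OF c(1)] entry_sum_nonneg[of p \<omega>]]
      by simp
    then have "exp (- (F \<iota> + c + 2 * p * ln B) / 2) \<le> \<omega> i i"
      using that by (subst ln_ge_iff[symmetric]) (auto simp: pos_graph_cone_def)
    then show ?thesis by (simp add: \<epsilon>_def)
  qed
  define T where "T = {\<omega> :: nat \<Rightarrow> nat \<Rightarrow> real. \<forall>i j. \<bar>\<omega> i j\<bar> \<le> B}
    \<inter> (graph_cone p E \<inter> (\<Inter>i\<in>{..<p}. {\<omega>. \<epsilon> \<le> \<omega> i i}))"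
  have "compact T"
    unfolding T_def
    by (intro compact_Int_closed compact_box closed_Int closed_graph_cone closed_INT ballI
        closed_Collect_le continuous_on_entry continuous_on_const)
  have "0 < \<epsilon>" by (simp add: \<epsilon>_def)
  then have T_pos: "0 < \<omega> i i" if "\<omega> \<in> T" "i < p" for \<omega> i
    using that by (force simp: T_def)
  have T_I: "\<omega> \<in> T" if "\<omega> \<in> pos_graph_cone p E" "F \<omega> \<le> F \<iota>" for \<omega>
  proof -
    have \<omega>: "\<omega> \<in> graph_cone p E" using that(1) by (simp add: pos_graph_cone_def)
    show ?thesis
      using \<omega> lower[OF that] order_trans[OF abs_entry_le_entry_sum[OF \<omega>] upper[OF that]]
      by (simp add: T_def)
  qed
  have "continuous_on T F"
    unfolding F_def objective_def
    by (intro continuous_on_add continuous_on_mult continuous_on_sum continuous_on_const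
        continuous_on_ln continuous_on_bform continuous_on_entry
        continuous_on_compose2[OF w_cont, of T "\<lambda>\<omega>. \<omega> _ _"])
       (auto dest: T_pos)
  then obtain \<sigma> where \<sigma>: "\<sigma> \<in> T" "\<forall>\<omega>\<in>T. F \<sigma> \<le> F \<omega>"
    using continuous_attains_inf[OF \<open>compact T\<close>] T_I[OF \<iota>] by blast
  have "\<sigma> \<in> pos_graph_cone p E"
    using \<sigma>(1) T_pos by (auto simp: pos_graph_cone_def T_def)
  \<comment> \<open>A competitor outside \<open>T\<close> has a value above
    \<open>F \<iota>\<close>, while \<open>\<iota>\<close> itself lies in \<open>T\<close>.\<close>
  moreover have "F \<sigma> \<le> F \<omega>" if "\<omega> \<in> pos_graph_cone p E" for \<omega>
    using \<sigma>(2) T_I[OF that] T_I[OF \<iota>] by fastforce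
  ultimately show ?thesis
    unfolding is_arg_min_def F_def by (metis not_less)
qed

text \<open>The criterion does not mention \<open>w\<close>, which is why different admissible
  weights lead to the same condition on \<open>a\<close>.\<close>

theorem unique_minimizer_iff:
  "has_unique_minimizer (objective p a w) (pos_graph_cone p E) \<longleftrightarrow> nondegenerate p E a"
  using nondegenerate_of_unique_minimizer minimizer_exists minimizer_unique
  unfolding has_unique_minimizer_def by blast

end

section \<open>The constant and the inverse weight\<close>

text \<open>Midpoint convexity of the form is its nonnegativity at \<open>x - y\<close>.\<close>

lemma unique_minimizer_const_weight_iff:
  assumes "\<And>j k. j < p \<Longrightarrow> k < p \<Longrightarrow> a j k = a k j" "\<And>x. 0 \<le> bform p a x x"
  shows "has_unique_minimizer (objective p a (\<lambda>_. 1)) (pos_graph_cone p E) \<longleftrightarrow> nondegenerate p E a"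
proof -
  have "weighted_objective p a (\<lambda>_. 1)"
  proof
    fix x y :: "nat \<Rightarrow> real"
    have "bform p a y x = bform p a x y"
      unfolding bform_def by (subst sum.swap) (auto intro!: sum.cong simp: assms(1))
    then show "1 * bform p a (\<lambda>j. 1/2 * x j + 1/2 * y j) (\<lambda>j. 1/2 * x j + 1/2 * y j)
        \<le> (1 * bform p a x x + 1 * bform p a y y) / 2"
      using assms(2)[of "\<lambda>j. 1 * x j + (- 1) * y j"]
      unfolding bform_combine_left bform_combine_right by (simp add: field_simps)
  qed (use assms in auto)
  then show ?thesis by (rule weighted_objective.unique_minimizer_iff)
qed

text \<open>The map taking \<open>(s, x)\<close> to the form at \<open>x\<close> divided by
  \<open>s\<close> is the perspective of a convex function, hence jointly convex.\<close>

lemma unique_minimizer_inverse_weight_iff: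
  assumes "\<And>j k. j < p \<Longrightarrow> k < p \<Longrightarrow> a j k = a k j" "\<And>x. 0 \<le> bform p a x x"
  shows "has_unique_minimizer (objective p a inverse) (pos_graph_cone p E) \<longleftrightarrow> nondegenerate p E a"
proof -
  have "weighted_objective p a inverse"
  proof
    fix x y :: "nat \<Rightarrow> real" and s t :: real
    assume "0 < s" "0 < t"
    define X Y Z where "X = bform p a x x" and "Y = bform p a y y" and "Z = bform p a x y"
    have comm: "bform p a y x = Z"
      unfolding bform_def Z_def by (subst sum.swap) (auto intro!: sum.cong simp: assms(1))
    have mid: "bform p a (\<lambda>j. 1/2 * x j + 1/2 * y j) (\<lambda>j. 1/2 * x j + 1/2 * y j)
        = (X + 2 * Z + Y) / 4"
      unfolding bform_combine_left bform_combine_right comm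
      by (simp add: X_def Y_def Z_def field_simps)
    \<comment> \<open>This is the form at \<open>t x - s y\<close>; divided by
      \<open>2 s t (s + t)\<close> it is exactly the midpoint gap.\<close>
    have "0 \<le> t * t * X - 2 * s * t * Z + s * s * Y"
      using assms(2)[of "\<lambda>j. t * x j + (- s) * y j"]
      unfolding bform_combine_left bform_combine_right comm
      by (simp add: X_def Y_def Z_def algebra_simps)
    then have "0 \<le> (t * t * X - 2 * s * t * Z + s * s * Y) / (2 * s * t * (s + t))"
      using \<open>0 < s\<close> \<open>0 < t\<close> by simp
    also have "\<dots> = (inverse s * X + inverse t * Y) / 2 - inverse ((s + t) / 2) * ((X + 2 * Z + Y) / 4)"
      using \<open>0 < s\<close> \<open>0 < t\<close> by (simp add: divide_simps) (simp add: algebra_simps)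
    finally show "inverse ((s + t) / 2)
        * bform p a (\<lambda>j. 1/2 * x j + 1/2 * y j) (\<lambda>j. 1/2 * x j + 1/2 * y j)
        \<le> (inverse s * bform p a x x + inverse t * bform p a y y) / 2"
      unfolding mid X_def[symmetric] Y_def[symmetric] by simp
  qed (use assms in \<open>auto intro!: continuous_on_inverse continuous_on_id simp: divide_inverse\<close>)
  then show ?thesis by (rule weighted_objective.unique_minimizer_iff)
qed


section \<open>General position of Gram matrices\<close>

text \<open>For the matrix \<open>F\<close> with entries \<open>f l j\<close>, this is the squared
  norm of \<open>F x\<close>, obtained by moving the sum over \<open>l\<close> outside.\<close>

lemma bform_gram:
  "bform p (\<lambda>j k. \<Sum>l<r. f l j * f l k) x x = (\<Sum>l<r. (\<Sum>j<p. f l j * x j)\<^sup>2)"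
proof -
  have "bform p (\<lambda>j k. \<Sum>l<r. f l j * f l k) x x
      = (\<Sum>j<p. \<Sum>k<p. \<Sum>l<r. (f l j * x j) * (f l k * x k))"
    unfolding bform_def by (simp add: sum_distrib_left sum_distrib_right algebra_simps)
  also have "\<dots> = (\<Sum>j<p. \<Sum>l<r. \<Sum>k<p. (f l j * x j) * (f l k * x k))"
    by (intro sum.cong refl sum.swap)
  also have "\<dots> = (\<Sum>l<r. \<Sum>j<p. \<Sum>k<p. (f l j * x j) * (f l k * x k))"
    by (rule sum.swap)
  also have "\<dots> = (\<Sum>l<r. (\<Sum>j<p. f l j * x j)\<^sup>2)"
    by (simp add: power2_eq_square sum_product)
  finally show ?thesis .
qed

lemma scalar_prod_mult_eq_bform:
  assumes "A \<in> carrier_mat p p" "v \<in> carrier_vec p"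
  shows "scalar_prod v (A *\<^sub>v v) = bform p (\<lambda>j k. A $$ (j, k)) (vec_index v) (vec_index v)"
  using assms unfolding bform_def scalar_prod_def
  by (auto simp: scalar_prod_def lessThan_atLeast0 sum_distrib_left algebra_simps intro!: sum.cong)

lemma bform_cong:
  assumes "\<And>j k. j < p \<Longrightarrow> k < p \<Longrightarrow> a j k = b j k" "\<And>j. j < p \<Longrightarrow> x j = y j"
  shows "bform p a x x = bform p b y y"
  unfolding bform_def using assms by (auto intro!: sum.cong)

section \<open>Minors that are nonzero almost everywhere\<close>

text \<open>Fubini in the coordinate \<open>a\<close>: where the slope \<open>g\<close> is nonzero,
  \<open>f\<close> has at most one zero on each line in that direction, and a point is a null
  set.\<close>

lemma AE_affine_coordinate_nonzero:
  fixes f g :: "('i \<Rightarrow> real) \<Rightarrow> real"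
  assumes "finite I" "a \<in> I"
    and [measurable]: "f \<in> borel_measurable (Pi\<^sub>M I (\<lambda>_. lborel))"
      "g \<in> borel_measurable (Pi\<^sub>M I (\<lambda>_. lborel))"
    and affine: "\<And>x y. f (x(a := y)) = y * g x + h x"
    and indep: "\<And>x y. g (x(a := y)) = g x"
  shows "AE x in Pi\<^sub>M I (\<lambda>_. lborel). g x \<noteq> 0 \<longrightarrow> f x \<noteq> 0"
proof -
  interpret product_sigma_finite "\<lambda>_ :: 'i. lborel :: real measure"
    by standard
  define M where "M = Pi\<^sub>M I (\<lambda>_. lborel :: real measure)"
  define N where "N = {x \<in> space M. g x \<noteq> 0 \<and> f x = 0}"
  have N: "N \<in> sets M" unfolding N_def M_def by measurable
  have I: "I = insert a (I - {a})" using assms(2) by blast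
  have "emeasure M N = (\<integral>\<^sup>+ x. indicator N x \<partial>Pi\<^sub>M (insert a (I - {a})) (\<lambda>_. lborel))"
    using N I by (simp add: M_def)
  also have "\<dots> = (\<integral>\<^sup>+ x. (\<integral>\<^sup>+ y. indicator N (x(a := y)) \<partial>lborel) \<partial>Pi\<^sub>M (I - {a}) (\<lambda>_. lborel))"
    using assms(1) N I by (intro product_nn_integral_insert) (auto simp: M_def)
  also have "\<dots> = (\<integral>\<^sup>+ x. 0 \<partial>Pi\<^sub>M (I - {a}) (\<lambda>_. lborel :: real measure))"
  proof (rule nn_integral_cong)
    fix x :: "'i \<Rightarrow> real"
    \<comment> \<open>If \<open>g x = 0\<close>, the section of \<open>N\<close> is empty, so the
      value of the division by zero does no harm.\<close>
    have "(\<integral>\<^sup>+ y. indicator N (x(a := y)) \<partial>lborel) \<le> (\<integral>\<^sup>+ y. indicator {- h x / g x} y \<partial>lborel)"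
      by (intro nn_integral_mono)
         (auto simp: N_def affine indep indicator_def field_simps eq_neg_iff_add_eq_0)
    also have "\<dots> = 0" by simp
    finally show "(\<integral>\<^sup>+ y. indicator N (x(a := y)) \<partial>lborel) = 0" by simp
  qed
  finally have "N \<in> null_sets M" using N by (auto simp: null_sets_def)
  then show ?thesis
    unfolding M_def[symmetric] by (rule AE_I') (auto simp: N_def)
qed

text \<open>By the Leibniz formula the determinant is a polynomial in the entries.\<close>

lemma borel_measurable_det:
  fixes F :: "'a \<Rightarrow> nat \<Rightarrow> nat \<Rightarrow> real"
  assumes "\<And>i j. i < n \<Longrightarrow> j < n \<Longrightarrow> (\<lambda>x. F x i j) \<in> borel_measurable M"
  shows "(\<lambda>x. det (mat n n (\<lambda>(i, j). F x i j))) \<in> borel_measurable M"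
proof -
  have "det (mat n n (\<lambda>(i, j). F x i j))
      = (\<Sum>\<pi> | \<pi> permutes {0..<n}. signof \<pi> * (\<Prod>i = 0..<n. F x i (\<pi> i)))" for x
    by (subst det_def'[OF mat_carrier])
       (auto intro!: sum.cong prod.cong simp: permutes_in_image[where S = "{0..<n}", simplified])
  then show ?thesis
    using assms
    by (auto intro!: borel_measurable_sum borel_measurable_times borel_measurable_prod
        simp: permutes_in_image[where S = "{0..<n}", simplified])
qed

text \<open>Expanding along the last row, the determinant is affine in its bottom right entry,
  and the slope is the next smaller determinant.\<close>
lemma AE_det_nonzero:
  fixes c :: "nat \<Rightarrow> nat"
  assumes "q \<le> r" "inj_on c {..<q}" "\<And>j. j < q \<Longrightarrow> c j < p"
  shows "AE x in Pi\<^sub>M ({..<r} \<times> {..<p}) (\<lambda>_. lborel :: real measure).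
    det (mat q q (\<lambda>(i, j). x (i, c j))) \<noteq> 0"
  using assms
proof (induction q)
  case 0
  have "det (mat 0 0 f :: real mat) = 1" for f
    by (rule det_dim_zero) simp
  then show ?case by simp
next
  case (Suc q)
  define M where "M = Pi\<^sub>M ({..<r} \<times> {..<p}) (\<lambda>_. lborel :: real measure)"
  define D where "D = (\<lambda>n (x :: nat \<times> nat \<Rightarrow> real). mat n n (\<lambda>(i, j). x (i, c j)))"
  \<comment> \<open>The terms of the last-row expansion that do not involve the bottom right
    entry.\<close>
  define h where "h = (\<lambda>x. \<Sum>j<q. x (q, c j) * cofactor (D (Suc q) x) q j)"
  have coord: "(\<lambda>x. x (i, c j)) \<in> borel_measurable M" if "i < Suc q" "j < Suc q" for i j
  proof -
    have "(i, c j) \<in> {..<r} \<times> {..<p}" using that Suc.prems by auto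
    then show ?thesis
      unfolding M_def using measurable_component_singleton[of "(i, c j)" _ "\<lambda>_. lborel :: real measure"]
      by (simp add: measurable_lborel2)
  qed
  have meas: "(\<lambda>x. det (D n x)) \<in> borel_measurable M" if "n \<le> Suc q" for n
    unfolding D_def using that coord by (intro borel_measurable_det) auto
  \<comment> \<open>Injectivity of \<open>c\<close> ensures that the coordinate
    \<open>(q, c q)\<close> occurs in no other entry of the last row.\<close>
  have c_neq: "c j \<noteq> c q" if "j < q" for j
    using inj_onD[OF Suc.prems(2), of j q] that by auto
  have delete: "mat_delete (D (Suc q) (x((q, c q) := y))) q j = mat_delete (D (Suc q) x) q j" for x y j
    by (rule eq_matI) (auto simp: D_def mat_delete_def)
  have small: "mat_delete (D (Suc q) x) q q = D q x" for x
    by (rule eq_matI) (auto simp: D_def mat_delete_def)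
  have expand: "det (D (Suc q) x) = (\<Sum>j<Suc q. x (q, c j) * cofactor (D (Suc q) x) q j)" for x
    by (subst laplace_expansion_row[where n = "Suc q" and i = q]) (auto simp: D_def)
  have "AE x in M. det (D q x) \<noteq> 0 \<longrightarrow> det (D (Suc q) x) \<noteq> 0"
    unfolding M_def
  proof (rule AE_affine_coordinate_nonzero[where a = "(q, c q)" and h = h])
    show "(\<lambda>x. det (D (Suc q) x)) \<in> borel_measurable (Pi\<^sub>M ({..<r} \<times> {..<p}) (\<lambda>_. lborel))"
      "(\<lambda>x. det (D q x)) \<in> borel_measurable (Pi\<^sub>M ({..<r} \<times> {..<p}) (\<lambda>_. lborel))"
      using meas[of "Suc q"] meas[of q] by (simp_all add: M_def)
    show "det (D (Suc q) (x((q, c q) := y))) = y * det (D q x) + h x" for x y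
      unfolding expand using c_neq by (simp add: h_def cofactor_def delete small)
    show "det (D q (x((q, c q) := y))) = det (D q x)" for x y
      by (rule arg_cong[of _ _ det], rule eq_matI) (auto simp: D_def)
  qed (use Suc.prems in auto)
  moreover have "AE x in M. det (D q x) \<noteq> 0"
    unfolding M_def D_def using Suc.prems by (intro Suc.IH) (auto simp: inj_on_def)
  ultimately show ?case
    unfolding M_def D_def by eventually_elim blast
qed

section \<open>Rank of Gram matrices\<close>

text \<open>A kernel vector of the Gram matrix has image of norm zero under all \<open>r\<close>
  rows of \<open>f\<close>, in particular under the first \<open>q\<close>, whose square block is
  invertible.\<close>

lemma det_gram_nonzero:
  fixes f :: "nat \<Rightarrow> nat \<Rightarrow> real"
  assumes "q \<le> r" "det (mat q q (\<lambda>(l, j). f l j)) \<noteq> 0"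
  shows "det (mat q q (\<lambda>(j, k). \<Sum>l<r. f l j * f l k)) \<noteq> 0"
proof
  define G where "G = mat q q (\<lambda>(j, k). \<Sum>l<r. f l j * f l k)"
  assume "det (mat q q (\<lambda>(j, k). \<Sum>l<r. f l j * f l k)) = 0"
  then obtain v where v: "v \<in> carrier_vec q" "v \<noteq> 0\<^sub>v q" "G *\<^sub>v v = 0\<^sub>v q"
    using det_0_iff_vec_prod_zero[of G q] by (auto simp: G_def)
  have "0 = scalar_prod v (G *\<^sub>v v)" using v by simp
  also have "\<dots> = bform q (\<lambda>j k. G $$ (j, k)) (vec_index v) (vec_index v)"
    using v(1) by (intro scalar_prod_mult_eq_bform) (auto simp: G_def)
  also have "\<dots> = bform q (\<lambda>j k. \<Sum>l<r. f l j * f l k) (vec_index v) (vec_index v)"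
    by (intro bform_cong) (auto simp: G_def)
  also have "\<dots> = (\<Sum>l<r. (\<Sum>j<q. f l j * vec_index v j)\<^sup>2)"
    by (rule bform_gram)
  finally have "\<forall>l\<in>{..<r}. (\<Sum>j<q. f l j * vec_index v j)\<^sup>2 = 0"
    by (subst sum_nonneg_eq_0_iff[symmetric]) auto
  then have "mat q q (\<lambda>(l, j). f l j) *\<^sub>v v = 0\<^sub>v q"
    using v(1) assms(1) by (intro eq_vecI) (auto simp: scalar_prod_def lessThan_atLeast0)
  then show False
    using v(1,2) assms(2) det_0_iff_vec_prod_zero[of "mat q q (\<lambda>(l, j). f l j)" q] by auto
qed

text \<open>The matrix is a sum of \<open>r\<close> matrices of rank at most 1.\<close>

lemma rank_gram_le:
  fixes f :: "nat \<Rightarrow> nat \<Rightarrow> real"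
  shows "vec_space.rank n (mat n n (\<lambda>(j, k). \<Sum>l<r. f l j * f l k)) \<le> r"
proof (induction r)
  case 0
  interpret vec_space "TYPE(real)" n .
  have "mat n n (\<lambda>(j, k). \<Sum>l<0. f l j * f l k) = 0\<^sub>m n n" by (rule eq_matI) auto
  then show ?case using rank_0I[of n] by (metis le_refl)
next
  case (Suc r)
  interpret vec_space "TYPE(real)" n .
  have split: "mat n n (\<lambda>(j, k). \<Sum>l<Suc r. f l j * f l k)
      = mat n n (\<lambda>(j, k). \<Sum>l<r. f l j * f l k) + mat n n (\<lambda>(j, k). f r j * f r k)"
    by (rule eq_matI) auto
  have "rank (mat n n (\<lambda>(j, k). f r j * f r k)) \<le> 1"
    by (rule rank_le_1_product_entries[where nc = n and f = "f r" and g = "f r"]) auto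
  then show ?case
    unfolding split
    using rank_subadditive[of "mat n n (\<lambda>(j, k). \<Sum>l<r. f l j * f l k)" n
        "mat n n (\<lambda>(j, k). f r j * f r k)"] Suc.IH
    by simp
qed

text \<open>The upper bounds come from the \<open>n\<close> columns and the \<open>r\<close>
  summands, the lower bound from the leading principal minor of order
  \<open>min n r\<close>.\<close>

lemma rank_gram:
  fixes f :: "nat \<Rightarrow> nat \<Rightarrow> real"
  assumes "det (mat (min n r) (min n r) (\<lambda>(l, j). f l j)) \<noteq> 0"
  shows "vec_space.rank n (mat n n (\<lambda>(j, k). \<Sum>l<r. f l j * f l k)) = min n r"
proof -
  interpret vec_space "TYPE(real)" n .
  define q where "q = min n r"
  define G where "G = mat n n (\<lambda>(j, k). \<Sum>l<r. f l j * f l k)"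
  have G: "G \<in> carrier_mat n n" by (simp add: G_def)
  have dims: "{i. i < n \<and> i < q} = {..<q}" by (auto simp: q_def)
  \<comment> \<open>On an initial segment \<open>pick\<close> is the identity, so the submatrix is
    the leading block.\<close>
  have pick: "pick {..<q} i = i" if "i < q" for i
    using pick_reduce_set[of i q UNIV] that by (simp add: pick_UNIV lessThan_def)
  have "submatrix G {..<q} {..<q} = mat q q (\<lambda>(j, k). \<Sum>l<r. f l j * f l k)"
    unfolding submatrix_def by (rule eq_matI) (auto simp: G_def dims pick, auto simp: q_def)
  then have "det (submatrix G {..<q} {..<q}) \<noteq> 0"
    using det_gram_nonzero[of q r f] assms by (simp add: q_def)
  then have "q \<le> rank G"
    using rank_gt_minor[OF G, of "{..<q}" "{..<q}"] by (simp add: dims)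
  moreover have "rank G \<le> n" by (rule rank_le_nc[OF G])
  moreover have "rank G \<le> r" unfolding G_def by (rule rank_gram_le)
  ultimately show ?thesis by (simp add: G_def q_def)
qed

lemma gram_index:
  fixes x :: "nat \<times> nat \<Rightarrow> real"
  assumes "j < p" "k < p"
  shows "(transpose_mat (mat r p x) * mat r p x) $$ (j, k) = (\<Sum>l<r. x (l, j) * x (l, k))"
  using assms by (auto simp: scalar_prod_def lessThan_atLeast0 intro!: sum.cong)

lemma gram_psd: "transpose_mat (mat r p x) * mat r p x \<in> psd_mats p"
proof -
  define A where "A = transpose_mat (mat r p x) * mat r p x"
  have A: "A \<in> carrier_mat p p" unfolding A_def by (rule mult_carrier_mat[of _ p r]) auto
  have idx: "A $$ (j, k) = (\<Sum>l<r. x (l, j) * x (l, k))" if "j < p" "k < p" for j k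
    unfolding A_def by (rule gram_index[OF that])
  have "transpose_mat A = A"
    using A by (intro eq_matI) (auto simp: idx mult.commute)
  moreover have "0 \<le> scalar_prod v (A *\<^sub>v v)" if "v \<in> carrier_vec p" for v
  proof -
    have "scalar_prod v (A *\<^sub>v v)
        = bform p (\<lambda>j k. \<Sum>l<r. x (l, j) * x (l, k)) (vec_index v) (vec_index v)"
      unfolding scalar_prod_mult_eq_bform[OF A that] by (intro bform_cong) (auto simp: idx)
    also have "\<dots> \<ge> 0"
      unfolding bform_gram[where f = "\<lambda>l j. x (l, j)"] by (intro sum_nonneg) simp
    finally show ?thesis .
  qed
  ultimately show ?thesis using A by (simp add: psd_mats_def sym_mats_def A_def)
qed

text \<open>Each of the finitely many \<open>I\<close> needs one minor of \<open>X\<close> in its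
  columns to be nonzero. Then \<open>rank_gram\<close> for these columns gives the rank of the
  principal submatrix.\<close>

lemma AE_gram_general_position:
  assumes "r \<le> p"
  shows "AE x in Pi\<^sub>M ({..<r} \<times> {..<p}) (\<lambda>_. lborel :: real measure).
    general_position p (transpose_mat (mat r p x) * mat r p x)
      \<and> vec_space.rank p (transpose_mat (mat r p x) * mat r p x) = r"
proof -
  define q where "q = (\<lambda>I :: nat set. min (card I) r)"
  have "AE x in Pi\<^sub>M ({..<r} \<times> {..<p}) (\<lambda>_. lborel :: real measure).
      \<forall>I\<in>Pow {..<p}. det (mat (q I) (q I) (\<lambda>(l, j). x (l, pick I j))) \<noteq> 0"
  proof (rule AE_finite_allI)
    fix I assume I: "I \<in> Pow {..<p}"
    then have "finite I" using finite_subset by blast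
    then have pick_in: "pick I j \<in> I" if "j < q I" for j
      using that by (intro pick_in_set_le) (simp add: q_def)
    moreover have "inj_on (pick I) {..<q I}"
    proof (rule linorder_inj_onI)
      fix j k assume "j < k" "k \<in> {..<q I}"
      then show "pick I j \<noteq> pick I k" using pick_mono_le[of k I j] by (simp add: q_def)
    qed auto
    ultimately show "AE x in Pi\<^sub>M ({..<r} \<times> {..<p}) (\<lambda>_. lborel :: real measure).
        det (mat (q I) (q I) (\<lambda>(l, j). x (l, pick I j))) \<noteq> 0"
      using I by (intro AE_det_nonzero) (force simp: q_def)+
  qed simp
  then show ?thesis
  proof eventually_elim
    case (elim x)
    define A where "A = transpose_mat (mat r p x) * mat r p x"
    have rank: "vec_space.rank (card I) (submatrix A I I) = min (card I) r" if "I \<subseteq> {..<p}" for I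
    proof -
      have dims: "{i. i < p \<and> i \<in> I} = I" using that by auto
      have pick: "pick I j < p" if "j < card I" for j
        using pick_le[of j p I] that by (simp add: dims)
      have "submatrix A I I
          = mat (card I) (card I) (\<lambda>(j, k). \<Sum>l<r. x (l, pick I j) * x (l, pick I k))"
        unfolding submatrix_def A_def
        by (rule eq_matI) (auto simp: dims gram_index pick simp del: index_mult_mat(1))
      then show ?thesis
        using rank_gram[of "card I" r "\<lambda>l j. x (l, pick I j)"] elim that by (simp add: q_def)
    qed
    \<comment> \<open>Taking all indices shows that \<open>A\<close> has rank
      \<open>min p r = r\<close>, as general position refers to the rank of \<open>A\<close>
      itself.\<close>
    have "submatrix A {..<p} {..<p} = A"
    proof -
      have "pick {..<p} i = i" if "i < p" for i
        using pick_reduce_set[of i p UNIV] that by (simp add: pick_UNIV lessThan_def)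
      then show ?thesis
        unfolding submatrix_def by (intro eq_matI) (auto simp: A_def simp del: index_mult_mat(1))
    qed
    then have "vec_space.rank p A = r"
      using rank[of "{..<p}"] assms by simp
    then show ?case
      using rank unfolding general_position_def A_def[symmetric] by simp
  qed
qed

section \<open>Comparison of the ranks\<close>

lemma has_unique_minimizer_bij_betw:
  assumes "bij_betw h D D'" "\<And>x. x \<in> D \<Longrightarrow> f (h x) = g x"
  shows "has_unique_minimizer f D' \<longleftrightarrow> has_unique_minimizer g D"
proof -
  have D': "D' = h ` D" using assms(1) by (simp add: bij_betw_def)
  have iff: "is_arg_min f (\<lambda>x. x \<in> D') (h x) \<longleftrightarrow> is_arg_min g (\<lambda>x. x \<in> D) x" if "x \<in> D" for x
    using that assms(2) unfolding is_arg_min_def D' by auto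
  have inj: "inj_on h D" using assms(1) by (simp add: bij_betw_def)
  show ?thesis
    unfolding has_unique_minimizer_def
  proof
    assume "\<exists>!y. is_arg_min f (\<lambda>x. x \<in> D') y"
    then obtain y where y: "is_arg_min f (\<lambda>x. x \<in> D') y"
      and uniq: "\<And>z. is_arg_min f (\<lambda>x. x \<in> D') z \<Longrightarrow> z = y" by blast
    then obtain x where x: "x \<in> D" "y = h x" unfolding is_arg_min_def D' by blast
    show "\<exists>!x. is_arg_min g (\<lambda>x. x \<in> D) x"
    proof
      show "is_arg_min g (\<lambda>x. x \<in> D) x" using y x iff by blast
    next
      fix z assume z: "is_arg_min g (\<lambda>x. x \<in> D) z"
      then have "z \<in> D" by (simp add: is_arg_min_def)
      then show "z = x" using z uniq[of "h z"] iff x inj by (simp add: inj_on_eq_iff)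
    qed
  next
    assume "\<exists>!x. is_arg_min g (\<lambda>x. x \<in> D) x"
    then obtain x where x: "is_arg_min g (\<lambda>x. x \<in> D) x"
      and uniq: "\<And>z. is_arg_min g (\<lambda>x. x \<in> D) z \<Longrightarrow> z = x" by blast
    have "x \<in> D" using x by (simp add: is_arg_min_def)
    show "\<exists>!y. is_arg_min f (\<lambda>x. x \<in> D') y"
    proof
      show "is_arg_min f (\<lambda>x. x \<in> D') (h x)" using x iff \<open>x \<in> D\<close> by blast
    next
      fix z assume z: "is_arg_min f (\<lambda>x. x \<in> D') z"
      then obtain u where "u \<in> D" "z = h u" unfolding is_arg_min_def D' by blast
      then show "z = h x" using z iff uniq by blast
    qed
  qed
qed

text \<open>The inverse pads with zeros, matching the convention that elements of the cone vanish
  outside the index range.\<close>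

lemma bij_betw_pos_graph_cone:
  "bij_betw (\<lambda>\<omega>. mat p p (\<lambda>(i, j). \<omega> i j)) (pos_graph_cone p E) (pos_diag_graph_mats p E)"
proof (rule bij_betw_byWitness[where
      f' = "\<lambda>\<Omega> i j. if i < p \<and> j < p then \<Omega> $$ (i, j) else 0"])
  have sym: "\<Omega> $$ (i, j) = \<Omega> $$ (j, i)" if "\<Omega> \<in> pos_diag_graph_mats p E" "i < p" "j < p" for \<Omega> i j
  proof -
    have "\<Omega> \<in> carrier_mat p p" "transpose_mat \<Omega> = \<Omega>"
      using that(1) by (auto simp: pos_diag_graph_mats_def graph_mats_def sym_mats_def)
    then show ?thesis using that(2,3) index_transpose_mat(1)[of i \<Omega> j] by simp
  qed
  show "(\<lambda>\<Omega> i j. if i < p \<and> j < p then \<Omega> $$ (i, j) else 0) ` pos_diag_graph_mats p E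
      \<subseteq> pos_graph_cone p E"
  proof (rule image_subsetI)
    fix \<Omega> assume \<Omega>: "\<Omega> \<in> pos_diag_graph_mats p E"
    show "(\<lambda>i j. if i < p \<and> j < p then \<Omega> $$ (i, j) else 0) \<in> pos_graph_cone p E"
      using \<Omega> sym[OF \<Omega>]
      by (auto simp: pos_graph_cone_def graph_cone_def pos_diag_graph_mats_def graph_mats_def
          intro: less_imp_le)
  qed
  show "(\<lambda>\<omega>. mat p p (\<lambda>(i, j). \<omega> i j)) ` pos_graph_cone p E \<subseteq> pos_diag_graph_mats p E"
    by (auto simp: pos_graph_cone_def graph_cone_def pos_diag_graph_mats_def graph_mats_def
        sym_mats_def intro!: eq_matI)
  show "\<forall>\<omega>\<in>pos_graph_cone p E.
      (\<lambda>i j. if i < p \<and> j < p then mat p p (\<lambda>(i, j). \<omega> i j) $$ (i, j) else 0) = \<omega>"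
    by (auto simp: pos_graph_cone_def graph_cone_def intro!: ext)
  show "\<forall>\<Omega>\<in>pos_diag_graph_mats p E.
      mat p p (\<lambda>(i, j). if i < p \<and> j < p then \<Omega> $$ (i, j) else 0) = \<Omega>"
    by (auto simp: pos_diag_graph_mats_def graph_mats_def sym_mats_def intro!: eq_matI)
qed

lemma
  assumes A: "A \<in> carrier_mat p p" and \<omega>: "\<omega> \<in> pos_graph_cone p E"
  shows concord_eq_objective:
      "concord p A (mat p p (\<lambda>(i, j). \<omega> i j)) = objective p (\<lambda>j k. A $$ (j, k)) (\<lambda>_. 1) \<omega>"
    and conspace_eq_objective:
      "conspace p A (mat p p (\<lambda>(i, j). \<omega> i j)) = objective p (\<lambda>j k. A $$ (j, k)) inverse \<omega>"
proof -
  let ?\<Omega> = "mat p p (\<lambda>(i, j). \<omega> i j)"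
  have "scalar_prod (col ?\<Omega> i) (A *\<^sub>v col ?\<Omega> i) = bform p (\<lambda>j k. A $$ (j, k)) (\<omega> i) (\<omega> i)"
    if "i < p" for i
  proof -
    \<comment> \<open>Symmetry of \<open>\<omega>\<close> turns the column into the row
      \<open>\<omega> i\<close>.\<close>
    have "vec_index (col ?\<Omega> i) j = \<omega> i j" if "j < p" for j
      using that \<open>i < p\<close> \<omega> by (simp add: pos_graph_cone_def graph_cone_def)
    then show ?thesis
      by (subst scalar_prod_mult_eq_bform[OF A]) (auto intro!: bform_cong carrier_vecI)
  qed
  then show "concord p A ?\<Omega> = objective p (\<lambda>j k. A $$ (j, k)) (\<lambda>_. 1) \<omega>"
    and "conspace p A ?\<Omega> = objective p (\<lambda>j k. A $$ (j, k)) inverse \<omega>"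
    by (simp_all add: concord_def conspace_def objective_def)
qed

text \<open>Both sides are equivalent to nondegeneracy of \<open>A\<close>.\<close>

lemma unique_minimizer_concord_iff_conspace:
  assumes "A \<in> psd_mats p"
  shows "has_unique_minimizer (concord p A) (pos_diag_graph_mats p E)
    \<longleftrightarrow> has_unique_minimizer (conspace p A) (pos_diag_graph_mats p E)"
proof -
  define a where "a = (\<lambda>j k. A $$ (j, k))"
  have A: "A \<in> carrier_mat p p" "transpose_mat A = A"
    using assms by (auto simp: psd_mats_def sym_mats_def)
  have sym: "a j k = a k j" if "j < p" "k < p" for j k
    using A that index_transpose_mat(1)[of j A k] by (simp add: a_def)
  have psd: "0 \<le> bform p a x x" for x
  proof -
    have "0 \<le> scalar_prod (Matrix.vec p x) (A *\<^sub>v Matrix.vec p x)"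
      using assms by (simp add: psd_mats_def)
    also have "\<dots> = bform p a x x"
      unfolding scalar_prod_mult_eq_bform[OF A(1) vec_carrier] a_def by (intro bform_cong) auto
    finally show ?thesis .
  qed
  have "has_unique_minimizer (concord p A) (pos_diag_graph_mats p E)
      \<longleftrightarrow> has_unique_minimizer (objective p a (\<lambda>_. 1)) (pos_graph_cone p E)"
    unfolding a_def
    by (intro has_unique_minimizer_bij_betw[OF bij_betw_pos_graph_cone] concord_eq_objective[OF A(1)])
  also have "\<dots> \<longleftrightarrow> nondegenerate p E a"
    by (rule unique_minimizer_const_weight_iff[OF sym psd])
  also have "\<dots> \<longleftrightarrow> has_unique_minimizer (objective p a inverse) (pos_graph_cone p E)"
    by (rule unique_minimizer_inverse_weight_iff[OF sym psd, symmetric])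
  also have "\<dots> \<longleftrightarrow> has_unique_minimizer (conspace p A) (pos_diag_graph_mats p E)"
    unfolding a_def
    by (intro has_unique_minimizer_bij_betw[OF bij_betw_pos_graph_cone, symmetric]
        conspace_eq_objective[OF A(1)])
  finally show ?thesis .
qed

text \<open>For any objective, almost every Gram matrix of \<open>r\<close> rows meets the
  hypotheses of the strong condition, so the strong rank satisfies the weak condition.\<close>

lemma weak_rank_le_strong_rank: "weak_rank F p E \<le> strong_rank F p E"
proof -
  define P where "P = (\<lambda>\<rho>. \<forall>A \<in> psd_mats p. general_position p A \<and> \<rho> \<le> vec_space.rank p A \<longrightarrow>
      has_unique_minimizer (F p A) (pos_diag_graph_mats p E))"
  \<comment> \<open>No \<open>p \<times> p\<close> matrix has rank \<open>p + 1\<close>, so the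
    condition holds vacuously and its least solution exists.\<close>
  have "P (p + 1)"
  proof -
    have "vec_space.rank p A \<le> p" if "A \<in> psd_mats p" for A
      using that by (intro vec_space.rank_le_nc) (simp add: psd_mats_def sym_mats_def)
    then show ?thesis unfolding P_def by fastforce
  qed
  then have P: "P (strong_rank F p E)"
    unfolding strong_rank_def P_def[symmetric] by (rule LeastI)
  have "almost_every_psd p (strong_rank F p E)
      (\<lambda>A. has_unique_minimizer (F p A) (pos_diag_graph_mats p E))"
    unfolding almost_every_psd_def
  proof (intro allI impI)
    fix r assume r: "strong_rank F p E \<le> r \<and> r \<le> p"
    have "AE x in Pi\<^sub>M ({..<r} \<times> {..<p}) (\<lambda>_. lborel :: real measure).
      general_position p (transpose_mat (mat r p x) * mat r p x)
        \<and> vec_space.rank p (transpose_mat (mat r p x) * mat r p x) = r"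
      using r by (intro AE_gram_general_position) simp
    then show "AE x in Pi\<^sub>M ({..<r} \<times> {..<p}) (\<lambda>_. lborel).
        has_unique_minimizer (F p (transpose_mat (mat r p x) * mat r p x)) (pos_diag_graph_mats p E)"
    proof eventually_elim
      case (elim x)
      then show ?case using P r gram_psd[where r = r and p = p and x = x] unfolding P_def by simp
    qed
  qed
  then show ?thesis unfolding weak_rank_def by (rule Least_le)
qed

theorem lemma3:
  fixes p :: nat and E :: "nat set set"
  assumes "p \<ge> 1" and "simple_graph p E"
  shows "weak_rank concord p E = weak_rank conspace p E
    \<and> weak_rank conspace p E \<le> strong_rank conspace p E
    \<and> strong_rank conspace p E = strong_rank concord p E"
proof (intro conjI)
  \<comment> \<open>The weak condition tests only Gram matrices, which are positive
    semidefinite.\<close>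
  show "weak_rank concord p E = weak_rank conspace p E"
    unfolding weak_rank_def almost_every_psd_def
    by (simp only: unique_minimizer_concord_iff_conspace[OF gram_psd])
  show "weak_rank conspace p E \<le> strong_rank conspace p E"
    by (rule weak_rank_le_strong_rank)
  show "strong_rank conspace p E = strong_rank concord p E"
    unfolding strong_rank_def
    by (simp add: unique_minimizer_concord_iff_conspace cong: ball_cong)
qed

end
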